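(* Let $m\ge0$ be an integer and let \[\theta(x)=\sum_{n=0}^{\infty}\frac{(n+1)(m+1)}{(n+m+1)(2m+1)}\,\mathcal{C}_{n+m+1,m}\,x^n.\] Then, as formal power series, $\theta(x)=\gamma_m(x)\gamma_0(x)=\gamma_m(x)\,\frac{1-\sqrt{1-4x}}{2x}$.
   Context: A path is a finite sequence of points of $\mathbb{Z}^2$ in which each step is $(1,0)$ or $(0,1)$. For integers $0\le m\le n$, $\mathcal{C}_{n,m}$ denotes the number of paths from $(0,-2m)$ to $(n-m,n-m)$ not crossing the line $y=x$, i.e. all of whose points $(p,q)$ satisfy $q\le p$. For $m\ge0$, $\gamma_m(x)=\sum_{n\ge0}\mathcal{C}_{n+m,m}x^n$; in particular $\gamma_0(x)=\frac{1-\sqrt{1-4x}}{2x}$, with $\sqrt{1-4x}$ the formal power series with constant term $1$ squaring to $1-4x$. *)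

theory Defs
  imports "HOL-Computational_Algebra.Formal_Power_Series"
begin

definition path_step :: "int \<times> int \<Rightarrow> int \<times> int \<Rightarrow> bool" where
  "path_step P Q \<longleftrightarrow> Q = (fst P + 1, snd P) \<or> Q = (fst P, snd P + 1)"

text \<open>A path is recorded as the list of all the points it visits, endpoints included.\<close>

definition is_path :: "(int \<times> int) list \<Rightarrow> bool" where
  "is_path ps \<longleftrightarrow> ps \<noteq> [] \<and> successively path_step ps"

definition path_from_to :: "int \<times> int \<Rightarrow> int \<times> int \<Rightarrow> (int \<times> int) list \<Rightarrow> bool" where
  "path_from_to P Q ps \<longleftrightarrow> is_path ps \<and> hd ps = P \<and> last ps = Q"

text \<open>The numbers \<open>C\<^bsub>n,m\<^esub>\<close>, meaningful for \<open>m \<le> n\<close>.\<close>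

definition path_count :: "nat \<Rightarrow> nat \<Rightarrow> nat" where
  "path_count n m =
     card {ps. path_from_to (0, - 2 * int m) (int n - int m, int n - int m) ps \<and>
               (\<forall>(p, q) \<in> set ps. q \<le> p)}"

definition gamma_series :: "nat \<Rightarrow> rat fps" where
  "gamma_series m = Abs_fps (\<lambda>n. of_nat (path_count (n + m) m))"

definition theta_series :: "nat \<Rightarrow> rat fps" where
  "theta_series m = Abs_fps (\<lambda>n.
     of_nat ((n + 1) * (m + 1)) / of_nat ((n + m + 1) * (2 * m + 1)) *
     of_nat (path_count (n + m + 1) m))"

definition sqrt_one_minus_4X :: "rat fps" where
  "sqrt_one_minus_4X = (THE s. fps_nth s 0 = 1 \<and> s ^ 2 = 1 - 4 * fps_X)"

lemma sqrt_one_minus_4X_unique_existence: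
  "\<exists>!s :: rat fps. fps_nth s 0 = 1 \<and> s ^ 2 = 1 - 4 * fps_X"
proof (rule ex_ex1I)
  let ?f = "1 - 4 * fps_X :: rat fps"
  let ?s = "fps_radical (\<lambda>_ _. 1) 2 ?f"
  have "?s ^ Suc 1 = ?f"
    using power_radical[of ?f "\<lambda>_ _. 1" 1] by (simp add: numeral_2_eq_2)
  moreover have "fps_nth ?s 0 = 1"
    by (simp add: fps_radical_def numeral_2_eq_2)
  ultimately show "\<exists>s :: rat fps. fps_nth s 0 = 1 \<and> s ^ 2 = ?f"
    by (intro exI[of _ ?s] conjI) (simp_all only: numeral_2_eq_2 One_nat_def)
next
  fix s t :: "rat fps"
  assume s: "fps_nth s 0 = 1 \<and> s ^ 2 = 1 - 4 * fps_X"
    and t: "fps_nth t 0 = 1 \<and> t ^ 2 = 1 - 4 * fps_X"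
  then have "s = t \<or> s = - t" by (simp add: power2_eq_iff[symmetric])
  moreover have "s \<noteq> - t"
  proof
    assume "s = - t"
    then have "fps_nth s 0 = - fps_nth t 0" by simp
    with s t show False by simp
  qed
  ultimately show "s = t" by blast
qed

lemma sqrt_one_minus_4X:
  "fps_nth sqrt_one_minus_4X 0 = 1" "sqrt_one_minus_4X ^ 2 = 1 - 4 * fps_X"
  using theI'[OF sqrt_one_minus_4X_unique_existence]
  by (simp_all add: sqrt_one_minus_4X_def)

text \<open>Since \<open>1 - sqrt_one_minus_4X\<close> has constant term 0, its quotient by \<open>2 * fps_X\<close>
  is exact: the division of formal power series does not drop any term here.\<close>

lemma div_two_X_exact:
  "(1 - sqrt_one_minus_4X) / (2 * fps_X) * (2 * fps_X) = 1 - sqrt_one_minus_4X"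
proof (rule dvd_div_mult_self)
  let ?f = "1 - sqrt_one_minus_4X"
  have "?f = fps_X * fps_shift 1 ?f"
    by (rule fps_ext) (simp add: sqrt_one_minus_4X(1))
  also have "\<dots> = 2 * fps_X * (fps_const (1 / 2) * fps_shift 1 ?f)"
  proof -
    have two: "2 * fps_const (1 / 2) = (1 :: rat fps)"
      by (simp add: numeral_fps_const)
    have "2 * fps_X * (fps_const (1 / 2) * g) = 2 * fps_const (1 / 2) * (fps_X * g)"
      for g :: "rat fps"
      by (simp only: mult.assoc mult.commute mult.left_commute)
    then show ?thesis by (simp only: two mult_1)
  qed
  finally show "2 * fps_X dvd ?f" by (rule dvdI)
qed

end

theory Submission
  imports Defs
begin

text \<open>Removing the first step of a path shows that the number of paths to a diagonal point with
  \<open>a\<close> horizontal and \<open>b\<close> vertical steps is a ballot number. The coefficients of the powers of the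
  Catalan series \<open>c = 1 + x c\<^sup>2\<close> obey the same recursion, because \<open>c\<^sup>k = c\<^sup>k\<^sup>-\<^sup>1 + x c\<^sup>k\<^sup>+\<^sup>1\<close>; hence
  \<open>\<gamma>\<^sub>m = c\<^sup>2\<^sup>m\<^sup>+\<^sup>1\<close>, and \<open>\<gamma>\<^sub>m \<gamma>\<^sub>0 = c\<^sup>2\<^sup>m\<^sup>+\<^sup>2\<close> again has ballot numbers as coefficients. The
  closed form of these numbers identifies them with the coefficients of \<open>\<theta>\<close>.\<close>

text \<open>Counts by the \<open>a\<close> horizontal and \<open>b\<close> vertical steps still
  ahead of a fixed diagonal endpoint. The start satisfies \<open>y \<le> x\<close> exactly when
  \<open>a \<le> b\<close>, hence the guard, which compares the predecessors.\<close>

fun ballot :: "nat \<Rightarrow> nat \<Rightarrow> nat" where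
  "ballot 0 b = 1"
| "ballot (Suc a) 0 = 0"
| "ballot (Suc a) (Suc b) = (if a \<le> b then ballot a (Suc b) + ballot (Suc a) b else 0)"

lemma ballot_eq_0: "b < a \<Longrightarrow> ballot a b = 0"
  by (cases a; cases b) auto

text \<open>Induction along the recursion, with denominators cleared. The range includes
  \<open>a = Suc b\<close>, where both sides vanish, so that for \<open>a = b\<close> the hypothesis
  still covers the summand \<open>ballot (Suc a) b\<close>.\<close>

lemma ballot_closed_form:
  "a \<le> Suc b \<Longrightarrow>
     rat_of_nat (ballot a b) * fact a * fact (Suc b) = (of_nat b + 1 - of_nat a) * fact (a + b)"
proof (induction a b rule: ballot.induct)
  case (1 b)
  then show ?case by simp
next
  case (2 a)
  then show ?case by simp
next
  case (3 a b)
  show ?case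
  proof (cases "a \<le> b")
    case False
    with 3 have "a = Suc b" by simp
    then show ?thesis by simp
  next
    case True
    have IH1: "rat_of_nat (ballot a (Suc b)) * fact a * fact (Suc (Suc b)) =
        (of_nat b + 2 - of_nat a) * fact (Suc (a + b))"
      using 3(1) True by (simp add: algebra_simps)
    have IH2: "rat_of_nat (ballot (Suc a) b) * fact (Suc a) * fact (Suc b) =
        (of_nat b - of_nat a) * fact (Suc (a + b))"
      using 3(2) True by (simp add: algebra_simps)
    \<comment> \<open>The factors \<open>a + 1\<close> and \<open>b + 2\<close> bring both summands
      to common factorials. What remains is (a+1)(b+2-a) + (b+2)(b-a) = (b+1-a)(a+b+2).\<close>
    have "rat_of_nat (ballot (Suc a) (Suc b)) * fact (Suc a) * fact (Suc (Suc b)) =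
        (of_nat a + 1) * (rat_of_nat (ballot a (Suc b)) * fact a * fact (Suc (Suc b))) +
        (of_nat b + 2) * (rat_of_nat (ballot (Suc a) b) * fact (Suc a) * fact (Suc b))"
      using True by (simp add: algebra_simps)
    also have "\<dots> = (of_nat (Suc b) + 1 - of_nat (Suc a)) *
        ((of_nat a + of_nat b + 2) * fact (Suc (a + b)))"
      unfolding IH1 IH2 by (simp only: of_nat_Suc) algebra
    also have "(of_nat a + of_nat b + 2) * fact (Suc (a + b)) = (fact (Suc a + Suc b) :: rat)"
      by (simp add: algebra_simps)
    finally show ?thesis .
  qed
qed

definition below_diagonal_paths :: "int \<times> int \<Rightarrow> int \<times> int \<Rightarrow> (int \<times> int) list set" where
  "below_diagonal_paths P Q = {ps. path_from_to P Q ps \<and> (\<forall>(p, q) \<in> set ps. q \<le> p)}"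

lemma below_diagonal_paths_above: "x < y \<Longrightarrow> below_diagonal_paths (x, y) Q = {}"
  by (auto simp: below_diagonal_paths_def path_from_to_def is_path_def
      dest!: bspec[OF _ hd_in_set])

lemma path_fst_mono: "is_path ps \<Longrightarrow> fst (hd ps) \<le> fst (last ps)"
proof (induction ps)
  case (Cons P ps)
  then show ?case
    by (cases ps) (auto simp: is_path_def path_step_def)
qed (simp add: is_path_def)

lemma below_diagonal_paths_right: "x' < x \<Longrightarrow> below_diagonal_paths (x, y) (x', y') = {}"
  by (auto simp: below_diagonal_paths_def path_from_to_def dest!: path_fst_mono)

lemma below_diagonal_paths_rec:
  assumes "y \<le> x"
  shows "below_diagonal_paths (x, y) Q =
    (if Q = (x, y) then {[(x, y)]} else {}) \<union>
    ((#) (x, y) ` below_diagonal_paths (x + 1, y) Q \<union>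
     (#) (x, y) ` below_diagonal_paths (x, y + 1) Q)"
    (is "?L = ?R")
proof (rule set_eqI)
  fix ps
  show "ps \<in> ?L \<longleftrightarrow> ps \<in> ?R"
  proof (cases ps)
    case Nil
    then show ?thesis
      by (auto simp: below_diagonal_paths_def path_from_to_def is_path_def)
  next
    case (Cons P qs)
    then show ?thesis using assms
      by (cases qs)
        (auto simp: below_diagonal_paths_def path_from_to_def is_path_def path_step_def
          image_iff)
  qed
qed

text \<open>With the start given relative to the endpoint, dropping the first step lowers
  \<open>a\<close> or \<open>b\<close> by one, as in the recursion of \<open>ballot\<close>.
  Finiteness is carried along because the cardinality of the union needs it.\<close>

lemma card_below_diagonal_paths:
  "finite (below_diagonal_paths (c - int a, c - int b) (c, c)) \<and>
   card (below_diagonal_paths (c - int a, c - int b) (c, c)) = ballot a b"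
proof (induction a b rule: ballot.induct)
  case (1 b)
  \<comment> \<open>The start lies in the column of the endpoint, so a horizontal step would
    overshoot and only the vertical path survives.\<close>
  show ?case
  proof (induction b)
    case 0
    then show ?case
      using below_diagonal_paths_rec[of c c "(c, c)"]
      by (simp add: below_diagonal_paths_right below_diagonal_paths_above)
  next
    case (Suc b)
    then show ?case
      using below_diagonal_paths_rec[of "c - int (Suc b)" c "(c, c)"]
      by (simp add: below_diagonal_paths_right card_image)
  qed
next
  case (2 a)
  then show ?case by (simp add: below_diagonal_paths_above)
next
  case (3 a b)
  show ?case
  proof (cases "a \<le> b")
    case False
    then show ?thesis by (simp add: below_diagonal_paths_above)
  next
    case True
    let ?P = "(c - int (Suc a), c - int (Suc b))"
    let ?A = "(#) ?P ` below_diagonal_paths (c - int a, c - int (Suc b)) (c, c)"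
    let ?B = "(#) ?P ` below_diagonal_paths (c - int (Suc a), c - int b) (c, c)"
    have "below_diagonal_paths ?P (c, c) = ?A \<union> ?B"
      using below_diagonal_paths_rec[of "c - int (Suc b)" "c - int (Suc a)" "(c, c)"] True
      by simp
    \<comment> \<open>The tails of the lists begin at different points.\<close>
    moreover have "?A \<inter> ?B = {}"
      by (auto simp: below_diagonal_paths_def path_from_to_def)
    ultimately show ?thesis
      using 3[OF True] True by (simp add: card_Un_disjoint card_image del: of_nat_Suc)
  qed
qed

lemma path_count_eq_ballot: "path_count (n + m) m = ballot n (n + 2 * m)"
  using card_below_diagonal_paths[of "int n" n "n + 2 * m"]
  by (simp add: path_count_def below_diagonal_paths_def)

definition catalan_series :: "rat fps" where
  "catalan_series = (1 - sqrt_one_minus_4X) / (2 * fps_X)"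

lemma catalan_series_eq: "catalan_series = 1 + fps_X * catalan_series ^ 2"
proof -
  let ?c = catalan_series
  have "sqrt_one_minus_4X = 1 - ?c * (2 * fps_X)"
    using div_two_X_exact unfolding catalan_series_def by simp
  then have "(1 - ?c * (2 * fps_X)) ^ 2 = 1 - 4 * fps_X"
    using sqrt_one_minus_4X(2) by simp
  \<comment> \<open>Expanding the square leaves a common nonzero factor \<open>4 * fps_X\<close>,
    which cancels in the integral domain of power series.\<close>
  then have "4 * fps_X * ?c = 4 * fps_X * (1 + fps_X * ?c ^ 2)"
    by algebra
  then show ?thesis
    by (simp only: mult_cancel_left) simp
qed

lemma catalan_series_nth_0: "fps_nth catalan_series 0 = 1"
  by (subst catalan_series_eq) simp

lemma catalan_series_power_Suc:
  "catalan_series ^ Suc k = catalan_series ^ k + fps_X * catalan_series ^ (k + 2)"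
proof -
  have "catalan_series ^ Suc k = (1 + fps_X * catalan_series ^ 2) * catalan_series ^ k"
    using catalan_series_eq by simp
  then show ?thesis
    by (simp add: algebra_simps power2_eq_square)
qed

text \<open>Comparing coefficients in \<open>catalan_series_power_Suc\<close> lowers either the
  index or the exponent. The lower index comes with a higher exponent, so the outer induction on
  \<open>n\<close> must keep \<open>d\<close> arbitrary.\<close>

lemma fps_nth_catalan_series_power:
  "fps_nth (catalan_series ^ Suc d) n = of_nat (ballot n (n + d))"
proof (induction n arbitrary: d)
  case 0
  then show ?case by (simp add: fps_nth_power_0 catalan_series_nth_0 del: power_Suc)
next
  case (Suc n)
  note IH = Suc.IH
  show ?case
  proof (induction d)
    case 0
    \<comment> \<open>Here the lower power is the constant 1, whose vanishing coefficient matches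
      \<open>ballot (Suc n) n = 0\<close>.\<close>
    show ?case
      using IH[of 1] by (subst catalan_series_power_Suc) (simp add: ballot_eq_0 del: power_Suc)
  next
    case (Suc d)
    show ?case
      using IH[of "d + 2"] Suc
      by (subst catalan_series_power_Suc) (simp add: del: power_Suc)
  qed
qed

lemma gamma_series_eq_catalan_power: "gamma_series m = catalan_series ^ Suc (2 * m)"
  by (rule fps_ext)
    (simp add: gamma_series_def path_count_eq_ballot fps_nth_catalan_series_power
      del: power_Suc)

text \<open>Both ballot numbers have the same second argument, so their closed forms share the
  factorials in \<open>?F\<close> and \<open>?G\<close> and differ only by linear factors.\<close>

lemma ballot_shift:
  "rat_of_nat ((n + 1) * (m + 1)) / of_nat ((n + m + 1) * (2 * m + 1)) *
     of_nat (ballot (Suc n) (Suc n + 2 * m)) = of_nat (ballot n (n + Suc (2 * m)))"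
proof -
  let ?B = "rat_of_nat (ballot (Suc n) (Suc n + 2 * m))"
  let ?B' = "rat_of_nat (ballot n (n + Suc (2 * m)))"
  let ?N = "rat_of_nat n" and ?M = "rat_of_nat m"
  let ?F = "fact n * fact (Suc (Suc n + 2 * m)) :: rat"
  let ?G = "fact (2 * n + 2 * m + 1) :: rat"
  have "?B * fact (Suc n) * fact (Suc (Suc n + 2 * m)) =
      (of_nat (Suc n + 2 * m) + 1 - of_nat (Suc n)) * fact (Suc n + (Suc n + 2 * m))"
    by (rule ballot_closed_form) simp
  moreover have "Suc n + (Suc n + 2 * m) = Suc (2 * n + 2 * m + 1)"
    by simp
  ultimately have "?B * fact (Suc n) * fact (Suc (Suc n + 2 * m)) =
      (2 * ?M + 1) * ((2 * ?N + 2 * ?M + 2) * ?G)"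
    by (simp only: fact_Suc of_nat_Suc of_nat_add of_nat_mult) (simp add: algebra_simps)
  then have B: "(?N + 1) * ?B * ?F = 2 * (2 * ?M + 1) * (?N + ?M + 1) * ?G"
    by (simp only: fact_Suc[of n] of_nat_Suc) (simp add: algebra_simps)
  have "?B' * fact n * fact (Suc (n + Suc (2 * m))) =
      (of_nat (n + Suc (2 * m)) + 1 - of_nat n) * fact (n + (n + Suc (2 * m)))"
    by (rule ballot_closed_form) simp
  moreover have "n + (n + Suc (2 * m)) = 2 * n + 2 * m + 1"
    by simp
  ultimately have B': "?B' * ?F = 2 * (?M + 1) * ?G"
    by (simp only: add_Suc add_Suc_right) (simp add: algebra_simps)
  have "((?N + 1) * (?M + 1) * ?B) * ?F = (?N + ?M + 1) * (2 * ?M + 1) * (2 * (?M + 1) * ?G)"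
    using B by algebra
  also have "\<dots> = ((?N + ?M + 1) * (2 * ?M + 1) * ?B') * ?F"
    using B' by algebra
  finally have "(?N + 1) * (?M + 1) * ?B = (?N + ?M + 1) * (2 * ?M + 1) * ?B'"
    by (simp only: mult_cancel_right) simp
  moreover have "(?N + ?M + 1) * (2 * ?M + 1) = of_nat ((n + m + 1) * (2 * m + 1))"
    "(?N + 1) * (?M + 1) = of_nat ((n + 1) * (m + 1))"
    by (simp_all only: of_nat_mult of_nat_add of_nat_1 of_nat_numeral)
  moreover have "rat_of_nat ((n + m + 1) * (2 * m + 1)) \<noteq> 0"
    by (simp only: of_nat_eq_0_iff) simp
  ultimately show ?thesis
    by (simp only: times_divide_eq_left nonzero_mult_div_cancel_left not_False_eq_True)
qed

lemma theta_series_eq_catalan_power: "theta_series m = catalan_series ^ Suc (Suc (2 * m))"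
proof (rule fps_ext)
  fix n
  have "path_count (n + m + 1) m = ballot (Suc n) (Suc n + 2 * m)"
    using path_count_eq_ballot[of "Suc n" m] by simp
  then show "fps_nth (theta_series m) n = fps_nth (catalan_series ^ Suc (Suc (2 * m))) n"
    by (simp only: theta_series_def fps_nth_Abs_fps ballot_shift fps_nth_catalan_series_power)
qed

theorem theorem7p2:
  fixes m :: nat
  shows "theta_series m = gamma_series m * gamma_series 0 \<and>
         gamma_series m * gamma_series 0 =
           gamma_series m * ((1 - sqrt_one_minus_4X) / (2 * fps_X))"
proof
  have g0: "gamma_series 0 = catalan_series"
    by (simp add: gamma_series_eq_catalan_power)
  show "theta_series m = gamma_series m * gamma_series 0"
    by (simp add: g0 theta_series_eq_catalan_power gamma_series_eq_catalan_power mult.commute)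
  show "gamma_series m * gamma_series 0 =
      gamma_series m * ((1 - sqrt_one_minus_4X) / (2 * fps_X))"
    by (simp only: g0 catalan_series_def)
qed

end
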